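(* There is a universal constant $C>0$ such that for every rooted tree $T_n$ with $n$ nodes and height $h$, every $V\ge0$ and every $\sigma>0$, the worst case risk of the least squares estimator $\hat\mu$ satisfies $$\sup_{\mu\in\mathcal F(T_n):\,\mu_1\le V}\ \mathbb E\,\frac1n\|\hat\mu-\mu\|^2\ \ge\ C\,\frac{\sigma^2}{h}\,\frac{\log(n/h)}{n}.$$
   Context: $T_n$ is a rooted tree with $n\ge 2$ nodes labelled $1,\dots,n$, node $1$ being the root; $\mathcal C(i)$ is the set of children of node $i$. The height $h$ is the maximum graph distance from the root to a leaf (so $h\ge1$). The set of flows is the closed convex cone $\mathcal F(T_n)=\{\mu\in\mathbb R^n:\ \mu_i\ge\sum_{j\in\mathcal C(i)}\mu_j\text{ for all }i\}$, an empty sum being $0$ (so $\mu_i\ge0$). $\mu_1$ is the root flow. One observes $Y_i=\mu_i+\epsilon_i$ with $\epsilon_i$ i.i.d. $N(0,\sigma^2)$. The least squares estimator is $\hat\mu=\operatorname{argmin}_{f\in\mathcal F(T_n)}\sum_{i=1}^n(Y_i-f_i)^2$. $\|\cdot\|$ is the Euclidean norm, and $\mathbb E$ is expectation under the true $\mu$. *)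

theory Defs
  imports "HOL-Probability.Probability" "Graph_Theory.Pair_Digraph"
begin

text \<open>
  A finite simple undirected graph is a \<open>pair_graph\<close>: a finite, symmetric, loop-free set of
  arcs. The library predicate \<open>tree\<close> is not usable here: it excludes directed cycles, and the
  two opposite arcs of an undirected edge form one. The edges carry no orientation; the root 1
  enters through \<open>children\<close> and \<open>height\<close>.
\<close>

definition rooted_tree :: "nat \<Rightarrow> nat pair_pre_digraph \<Rightarrow> bool" where
  "rooted_tree n G \<longleftrightarrow> 2 \<le> n \<and> pair_graph G \<and> pverts G = {1..n} \<and>
     (\<forall>u\<in>pverts G. \<forall>v\<in>pverts G. \<exists>!p. pre_digraph.apath (with_proj G) u p v)"

text \<open>\<open>j\<close> is a child of \<open>i\<close> iff \<open>i\<close> is the last vertex before \<open>j\<close> on the path from the root to \<open>j\<close>.\<close>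

definition children :: "nat pair_pre_digraph \<Rightarrow> nat \<Rightarrow> nat set" where
  "children G i = {j. \<exists>p. pre_digraph.apath (with_proj G) 1 (p @ [(i, j)]) j}"

definition leaves :: "nat pair_pre_digraph \<Rightarrow> nat set" where
  "leaves G = {i \<in> pverts G. children G i = {}}"

definition graph_dist :: "nat pair_pre_digraph \<Rightarrow> nat \<Rightarrow> nat \<Rightarrow> nat" where
  "graph_dist G u v = (LEAST k. \<exists>p. pre_digraph.awalk (with_proj G) u p v \<and> length p = k)"

definition height :: "nat pair_pre_digraph \<Rightarrow> nat" where
  "height G = Max (graph_dist G 1 ` leaves G)"

text \<open>
  \<open>\<real>\<^sup>n\<close> is represented by the functions that are \<open>undefined\<close> off \<open>{1..n}\<close>, so that vectors with
  equal coordinates are equal and the least squares estimator is unique.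
\<close>

definition flows :: "nat pair_pre_digraph \<Rightarrow> (nat \<Rightarrow> real) set" where
  "flows G = {\<mu> \<in> pverts G \<rightarrow>\<^sub>E UNIV. \<forall>i\<in>pverts G. (\<Sum>j\<in>children G i. \<mu> j) \<le> \<mu> i}"

definition lse :: "nat pair_pre_digraph \<Rightarrow> (nat \<Rightarrow> real) \<Rightarrow> (nat \<Rightarrow> real)" where
  "lse G Y = (ARG_MIN (\<lambda>f. \<Sum>i\<in>pverts G. (Y i - f i)\<^sup>2) f. f \<in> flows G)"

text \<open>The joint law of \<open>n\<close> independent \<open>N(0, \<sigma>\<^sup>2)\<close> variables.\<close>

definition noise :: "nat \<Rightarrow> real \<Rightarrow> (nat \<Rightarrow> real) measure" where
  "noise n \<sigma> = (\<Pi>\<^sub>M i\<in>{1..n}. density lborel (\<lambda>x. ennreal (normal_density 0 \<sigma> x)))"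

text \<open>
  The loss is nonnegative, so its expectation is taken in \<open>[0, \<infinity>]\<close>; neither it nor a supremum
  of such expectations then depends on integrability or boundedness conventions.
\<close>

definition risk :: "nat \<Rightarrow> nat pair_pre_digraph \<Rightarrow> real \<Rightarrow> (nat \<Rightarrow> real) \<Rightarrow> ennreal" where
  "risk n G \<sigma> \<mu> = (\<integral>\<^sup>+ \<epsilon>. ennreal ((1 / real n) *
      (\<Sum>i=1..n. (lse G (\<lambda>i. \<mu> i + \<epsilon> i) i - \<mu> i)\<^sup>2)) \<partial>noise n \<sigma>)"

end

theory Submission
  imports Defs
begin

text \<open>
  At the zero flow the loss is the squared norm of the projection of the noise onto the cone of
  flows, which is at least \<open>\<langle>\<epsilon>, f\<rangle>\<^sup>2 / \<parallel>f\<parallel>\<^sup>2\<close> for every flow \<open>f\<close> with \<open>\<langle>\<epsilon>, f\<rangle> \<ge> 0\<close>. Take for \<open>f\<close>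
  the indicator of the path from the root to a leaf, so that \<open>\<parallel>f\<parallel>\<^sup>2 \<le> h + 1\<close>. These paths cover the
  tree, hence there are at least \<open>(n - 1) / h\<close> leaves, and the largest noise variable at a leaf is
  of order \<open>\<sigma> \<surd>(log (n / h))\<close> with probability bounded below. The noise at the other nodes of a
  path is symmetric and independent of the noise at the leaves, so it decreases the path sum with
  probability at most one half.
\<close>

section \<open>Maxima of Gaussian sums\<close>

abbreviation normal_law :: "real \<Rightarrow> real measure" where
  "normal_law \<sigma> \<equiv> density lborel (\<lambda>x. ennreal (normal_density 0 \<sigma> x))"

lemma emeasure_normal_law_uminus:
  assumes "B \<in> sets borel"
  shows "emeasure (normal_law \<sigma>) (uminus -` B) = emeasure (normal_law \<sigma>) B"
proof -
  have [measurable]: "B \<in> sets borel" "uminus -` B \<in> sets borel"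
    using assms measurable_sets_borel[of uminus borel B] by auto
  have "emeasure (normal_law \<sigma>) B = (\<integral>\<^sup>+x. ennreal (normal_density 0 \<sigma> x) * indicator B x \<partial>distr lborel borel uminus)"
    by (simp add: emeasure_density lborel_distr_uminus)
  also have "\<dots> = (\<integral>\<^sup>+x. ennreal (normal_density 0 \<sigma> x) * indicator (uminus -` B) x \<partial>lborel)"
    by (subst nn_integral_distr)
       (auto simp: normal_density_def indicator_def intro!: nn_integral_cong)
  also have "\<dots> = emeasure (normal_law \<sigma>) (uminus -` B)" by (simp add: emeasure_density)
  finally show ?thesis by simp
qed

text \<open>The density decreases on the positive half-line, so the interval from
  \<open>t * \<sigma>\<close> to \<open>(t + 1) * \<sigma>\<close> has at least the mass given by
  its length times the density at its right end.\<close>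

lemma normal_tail_lower_bound:
  assumes \<sigma>: "0 < \<sigma>" and t: "0 \<le> t"
  shows "exp (- ((t + 1)\<^sup>2 / 2)) / sqrt (2 * pi) \<le> measure (normal_law \<sigma>) {t * \<sigma>..}"
proof -
  interpret prob_space "normal_law \<sigma>" using \<sigma> by (rule prob_space_normal_density)
  define c where "c = exp (- ((t + 1)\<^sup>2 / 2)) / sqrt (2 * pi)"
  have "ennreal c = (\<integral>\<^sup>+x. ennreal (c / \<sigma>) * indicator {t * \<sigma>..(t + 1) * \<sigma>} x \<partial>lborel)"
    using \<sigma> by (subst nn_integral_cmult_indicator)
      (auto simp: ennreal_mult'[symmetric] left_diff_distrib[symmetric] mult_right_mono c_def)
  also have "\<dots> \<le> (\<integral>\<^sup>+x. ennreal (normal_density 0 \<sigma> x) * indicator {t * \<sigma>..} x \<partial>lborel)"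
  proof (intro nn_integral_mono)
    fix x
    have "c / \<sigma> \<le> normal_density 0 \<sigma> x" if x: "t * \<sigma> \<le> x" "x \<le> (t + 1) * \<sigma>"
    proof -
      have "0 \<le> x" using x(1) \<sigma> t by (meson order_trans mult_nonneg_nonneg less_imp_le)
      then have "x\<^sup>2 \<le> ((t + 1) * \<sigma>)\<^sup>2" using x(2) by (intro power_mono)
      then have "x\<^sup>2 / (2 * \<sigma>\<^sup>2) \<le> (t + 1)\<^sup>2 / 2" using \<sigma> by (simp add: power_mult_distrib divide_simps)
      moreover have "sqrt (2 * pi * \<sigma>\<^sup>2) = sqrt (2 * pi) * \<sigma>" using \<sigma> by (simp add: real_sqrt_mult)
      ultimately show ?thesis using \<sigma> by (simp add: c_def normal_density_def field_simps)
    qed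
    then show "ennreal (c / \<sigma>) * indicator {t * \<sigma>..(t + 1) * \<sigma>} x
        \<le> ennreal (normal_density 0 \<sigma> x) * indicator {t * \<sigma>..} x"
      by (auto simp: indicator_def ennreal_leI)
  qed
  also have "\<dots> = ennreal (measure (normal_law \<sigma>) {t * \<sigma>..})"
    by (simp add: emeasure_density flip: emeasure_eq_measure)
  finally show ?thesis by (simp add: c_def)
qed

text \<open>Chosen so that, for every \<open>L \<ge> 1\<close>, a normal variable exceeds
  \<open>sqrt (ln (L + 1)) * \<sigma>\<close> with probability at least
  \<open>tail_const / L\<close>: \<open>exp (- 1)\<close> pays for
  \<open>(t + 1)\<^sup>2 / 2 \<le> t\<^sup>2 + 1\<close>, the 2 for
  \<open>L + 1 \<le> 2 * L\<close>, and the root normalizes the density.\<close>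

definition tail_const :: real where
  "tail_const = exp (- 1) / (2 * sqrt (2 * pi))"

lemma tail_const_pos: "0 < tail_const"
  by (simp add: tail_const_def)

lemma product_prob_space_normal: "0 < \<sigma> \<Longrightarrow> product_prob_space (\<lambda>_. normal_law \<sigma>)"
  by (intro product_prob_spaceI prob_space_normal_density)

text \<open>Each coordinate in \<open>A\<close> reaches the threshold with probability
  \<open>q \<ge> tail_const / card A\<close>. By independence all of them miss it with probability
  \<open>(1 - q) ^ card A\<close>, which is at most \<open>exp (- (q * card A))\<close>.\<close>

lemma prob_max_normal_ge:
  fixes I :: "'a set"
  assumes \<sigma>: "0 < \<sigma>" and fin: "finite I" and A: "A \<subseteq> I" "A \<noteq> {}"
  shows "1 - exp (- tail_const) \<le> measure (\<Pi>\<^sub>M i\<in>I. normal_law \<sigma>)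
    {\<epsilon> \<in> space (\<Pi>\<^sub>M i\<in>I. normal_law \<sigma>). \<exists>k\<in>A. sqrt (ln (real (card A) + 1)) * \<sigma> \<le> \<epsilon> k}"
proof -
  let ?N = "normal_law \<sigma>" and ?M = "\<Pi>\<^sub>M i\<in>I. normal_law \<sigma>"
  define L where "L = real (card A)"
  define t where "t = sqrt (ln (L + 1))"
  interpret N: prob_space ?N using \<sigma> by (rule prob_space_normal_density)
  interpret product_prob_space "\<lambda>_. ?N" I using \<sigma> by (rule product_prob_space_normal)
  interpret finite_product_prob_space "\<lambda>_. ?N" I by unfold_locales fact
  have finA: "finite A" using A fin finite_subset by blast
  then have L: "1 \<le> L" using A(2) by (simp add: L_def Suc_le_eq card_gt_0_iff)
  have t: "0 \<le> t" "t\<^sup>2 = ln (L + 1)" using L by (auto simp: t_def)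
  define q where "q = N.prob {t * \<sigma>..}"
  have "exp (- 1) / (L + 1) = exp (- t\<^sup>2 - 1)"
    using L t(2) by (simp add: exp_diff exp_minus field_simps)
  \<comment> \<open>Since \<open>(t - 1)\<^sup>2 \<ge> 0\<close> gives
    \<open>(t + 1)\<^sup>2 / 2 \<le> t\<^sup>2 + 1\<close>.\<close>
  also have "\<dots> \<le> exp (- ((t + 1)\<^sup>2 / 2))"
    using zero_le_power2[of "t - 1"] by (simp add: power2_eq_square field_simps)
  finally have "exp (- 1) / (L + 1) / sqrt (2 * pi) \<le> exp (- ((t + 1)\<^sup>2 / 2)) / sqrt (2 * pi)"
    by (intro divide_right_mono) auto
  also have "\<dots> \<le> q" unfolding q_def using normal_tail_lower_bound[OF \<sigma> t(1)] .
  finally have "exp (- 1) / (L + 1) / sqrt (2 * pi) \<le> q" .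
  moreover have "tail_const / L \<le> exp (- 1) / (L + 1) / sqrt (2 * pi)"
  proof -
    have "tail_const / L = exp (- 1) / (2 * L) / sqrt (2 * pi)" by (simp add: tail_const_def)
    also have "\<dots> \<le> exp (- 1) / (L + 1) / sqrt (2 * pi)"
      using L by (intro divide_right_mono divide_left_mono) auto
    finally show ?thesis .
  qed
  ultimately have "tail_const / L \<le> q" by linarith
  then have q: "tail_const \<le> q * L" using L by (simp add: pos_divide_le_eq)
  have "{t * \<sigma>..} = space ?N - {..<t * \<sigma>}" by auto
  then have compl: "N.prob {..<t * \<sigma>} = 1 - q"
    using N.prob_compl[of "{..<t * \<sigma>}"] by (simp add: q_def)
  let ?E = "{\<epsilon> \<in> space ?M. \<exists>k\<in>A. t * \<sigma> \<le> \<epsilon> k}"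
  \<comment> \<open>The complementary event is a box, so its probability is a product over the
    coordinates.\<close>
  let ?B = "\<Pi>\<^sub>E i\<in>I. if i \<in> A then {..<t * \<sigma>} else UNIV"
  have "(\<forall>i\<in>I. \<epsilon> i \<in> (if i \<in> A then {..<t * \<sigma>} else UNIV)) \<longleftrightarrow> (\<forall>k\<in>A. \<epsilon> k < t * \<sigma>)"
    for \<epsilon> :: "'a \<Rightarrow> real"
    using A(1) by (auto split: if_splits)
  then have B: "\<epsilon> \<in> ?B \<longleftrightarrow> (\<forall>k\<in>A. \<epsilon> k < t * \<sigma>) \<and> \<epsilon> \<in> extensional I" for \<epsilon>
    unfolding PiE_iff by blast
  have "space ?M = extensional I" by (auto simp: space_PiM PiE_def)
  then have E: "?E = space ?M - ?B"
    unfolding set_eq_iff Diff_iff mem_Collect_eq B not_less[symmetric] by blast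
  have "measure ?M ?B = (\<Prod>i\<in>I. N.prob (if i \<in> A then {..<t * \<sigma>} else UNIV))"
    by (intro prob_times) auto
  also have "\<dots> = (\<Prod>i\<in>I. if i \<in> A then 1 - q else 1)"
    using compl N.prob_space by (intro prod.cong) auto
  also have "\<dots> = (1 - q) ^ card A"
    using fin A by (simp add: prod.If_cases Int_absorb1)
  also have "\<dots> \<le> exp (- q) ^ card A"
    using exp_ge_add_one_self[of "- q"] N.prob_le_1 by (intro power_mono) (auto simp: q_def)
  also have "\<dots> = exp (- (q * L))" by (simp add: L_def flip: exp_of_nat_mult)
  also have "\<dots> \<le> exp (- tail_const)" using q by simp
  finally have "measure ?M ?B \<le> exp (- tail_const)" .
  moreover have "?B \<in> sets ?M" using fin by (intro sets_PiM_I_finite) auto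
  ultimately have "1 - exp (- tail_const) \<le> measure ?M ?E"
    unfolding E by (subst prob_compl) auto
  then show ?thesis by (simp add: t_def L_def)
qed

section \<open>Symmetrization by partial sign flips\<close>

definition flip_off :: "'a set \<Rightarrow> 'a set \<Rightarrow> ('a \<Rightarrow> real) \<Rightarrow> 'a \<Rightarrow> real" where
  "flip_off I A \<epsilon> = (\<lambda>i\<in>I. if i \<in> A then \<epsilon> i else - \<epsilon> i)"

lemma measurable_flip_off [measurable]:
  "flip_off I A \<in> measurable (\<Pi>\<^sub>M i\<in>I. normal_law \<sigma>) (\<Pi>\<^sub>M i\<in>I. normal_law \<sigma>)"
  unfolding flip_off_def by (intro measurable_restrict) (auto split: if_split)

text \<open>A product measure is determined by boxes. The flip pulls a box back to the box with the
  sides off \<open>A\<close> reflected, and the normal law is invariant under reflection.\<close>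

lemma distr_flip_off:
  assumes \<sigma>: "0 < \<sigma>" and fin: "finite I"
  shows "distr (\<Pi>\<^sub>M i\<in>I. normal_law \<sigma>) (\<Pi>\<^sub>M i\<in>I. normal_law \<sigma>) (flip_off I A) = (\<Pi>\<^sub>M i\<in>I. normal_law \<sigma>)"
proof -
  interpret product_prob_space "\<lambda>_. normal_law \<sigma>" I using \<sigma> by (rule product_prob_space_normal)
  let ?M = "\<Pi>\<^sub>M i\<in>I. normal_law \<sigma>"
  show ?thesis
  proof (rule PiM_eqI[OF fin])
    show "sets (distr ?M ?M (flip_off I A)) = sets ?M" by simp
    fix B :: "'a \<Rightarrow> real set"
    assume B: "\<And>i. i \<in> I \<Longrightarrow> B i \<in> sets (normal_law \<sigma>)"
    define B' where "B' i = (if i \<in> A then B i else uminus -` B i)" for i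
    have B': "B' i \<in> sets (normal_law \<sigma>)" if "i \<in> I" for i
      using B[OF that] measurable_sets_borel[of uminus borel "B i"] by (auto simp: B'_def)
    have "flip_off I A -` PiE I B \<inter> space ?M = PiE I B'"
      by (auto simp: flip_off_def B'_def space_PiM PiE_iff split: if_splits)
    then have "emeasure (distr ?M ?M (flip_off I A)) (PiE I B) = emeasure ?M (PiE I B')"
      using B fin by (subst emeasure_distr) (auto intro!: sets_PiM_I_finite)
    also have "\<dots> = (\<Prod>i\<in>I. emeasure (normal_law \<sigma>) (B' i))"
      using B' fin by (intro emeasure_PiM)
    also have "\<dots> = (\<Prod>i\<in>I. emeasure (normal_law \<sigma>) (B i))"
      using B by (intro prod.cong) (auto simp: B'_def emeasure_normal_law_uminus)
    finally show "emeasure (distr ?M ?M (flip_off I A)) (PiE I B)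
        = (\<Prod>i\<in>I. emeasure (normal_law \<sigma>) (B i))" .
  qed
qed

text \<open>Flipping the signs off \<open>A\<close> preserves the law and, as \<open>S k\<close>
  meets \<open>A\<close> in \<open>k\<close> only, negates every other term of the sum over
  \<open>S k\<close>. The sums before and after the flip average to \<open>\<epsilon> k\<close>, so
  one of them is at least \<open>\<epsilon> k\<close>. One flip serves all \<open>k\<close>, hence
  the loss is a factor 2 and not one that grows with \<open>card A\<close>.\<close>

lemma prob_some_sum_ge:
  fixes I :: "'a set"
  assumes \<sigma>: "0 < \<sigma>" and fin: "finite I" and A: "A \<subseteq> I"
    and S: "\<And>k. k \<in> A \<Longrightarrow> S k \<subseteq> I" "\<And>k. k \<in> A \<Longrightarrow> S k \<inter> A = {k}"
  defines "M \<equiv> \<Pi>\<^sub>M i\<in>I. normal_law \<sigma>"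
  shows "measure M {\<epsilon> \<in> space M. \<exists>k\<in>A. t \<le> \<epsilon> k}
    \<le> 2 * measure M {\<epsilon> \<in> space M. \<exists>k\<in>A. t \<le> (\<Sum>i\<in>S k. \<epsilon> i)}"
proof -
  interpret M: prob_space M unfolding M_def by (rule prob_space_PiM) (rule prob_space_normal_density[OF \<sigma>])
  have finA: "finite A" using A fin finite_subset by blast
  define E where "E = {\<epsilon> \<in> space M. \<exists>k\<in>A. t \<le> (\<Sum>i\<in>S k. \<epsilon> i)}"
  define T where "T = flip_off I A"
  have T: "T \<in> measurable M M" unfolding T_def M_def by measurable
  have coord: "(\<lambda>\<epsilon>. \<epsilon> i) \<in> borel_measurable M" if "i \<in> I" for i
    using measurable_component_singleton[OF that, of "\<lambda>_. normal_law \<sigma>"] unfolding M_def by simp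
  have "(\<lambda>\<epsilon>. \<Sum>i\<in>S k. \<epsilon> i) \<in> borel_measurable M" if "k \<in> A" for k
    using S(1)[OF that] coord by (intro borel_measurable_sum) auto
  then have "{\<epsilon> \<in> space M. t \<le> (\<Sum>i\<in>S k. \<epsilon> i)} \<in> sets M" if "k \<in> A" for k
    using that by measurable
  then have E: "E \<in> sets M"
    unfolding E_def using finA by (intro sets.sets_Collect_finite_Ex)
  have "{\<epsilon> \<in> space M. \<exists>k\<in>A. t \<le> \<epsilon> k} \<subseteq> E \<union> (T -` E \<inter> space M)"
  proof
    fix \<epsilon> assume "\<epsilon> \<in> {\<epsilon> \<in> space M. \<exists>k\<in>A. t \<le> \<epsilon> k}"
    then obtain k where \<epsilon>: "\<epsilon> \<in> space M" and k: "k \<in> A" "t \<le> \<epsilon> k" by blast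
    have "k \<in> S k" using S(2)[OF k(1)] by blast
    have finS: "finite (S k)" using S(1)[OF k(1)] fin finite_subset by blast
    have "T \<epsilon> i = - \<epsilon> i" if "i \<in> S k - {k}" for i
      using S[OF k(1)] that by (auto simp: T_def flip_off_def)
    then have "(\<Sum>i\<in>S k - {k}. T \<epsilon> i) = - (\<Sum>i\<in>S k - {k}. \<epsilon> i)"
      by (simp add: sum_negf)
    moreover have "T \<epsilon> k = \<epsilon> k" using k(1) A by (auto simp: T_def flip_off_def)
    ultimately have "t \<le> (\<Sum>i\<in>S k. \<epsilon> i) \<or> t \<le> (\<Sum>i\<in>S k. T \<epsilon> i)"
      using k(2) sum.remove[OF finS \<open>k \<in> S k\<close>, of \<epsilon>] sum.remove[OF finS \<open>k \<in> S k\<close>, of "T \<epsilon>"]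
      by linarith
    moreover have "T \<epsilon> \<in> space M" using T \<epsilon> by (rule measurable_space)
    ultimately show "\<epsilon> \<in> E \<union> (T -` E \<inter> space M)" using \<epsilon> k(1) by (auto simp: E_def)
  qed
  then have "measure M {\<epsilon> \<in> space M. \<exists>k\<in>A. t \<le> \<epsilon> k} \<le> measure M (E \<union> (T -` E \<inter> space M))"
    using E measurable_sets[OF T E] by (intro M.finite_measure_mono) auto
  also have "\<dots> \<le> measure M E + measure M (T -` E \<inter> space M)"
    using E measurable_sets[OF T E] by (intro measure_Un_le) auto
  also have "measure M (T -` E \<inter> space M) = measure (distr M M T) E"
    using T E by (simp add: measure_distr)
  also have "distr M M T = M" unfolding M_def T_def using \<sigma> fin by (rule distr_flip_off)
  finally show ?thesis by (simp add: E_def)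
qed

section \<open>Existence of least squares estimators\<close>

text \<open>Off \<open>I\<close> the coordinates range over the singleton of
  \<open>undefined\<close>, so the set is a full product of compact sets and Tychonoff's theorem
  applies.\<close>

lemma compact_PiE:
  fixes S :: "'a \<Rightarrow> 'b::topological_space set"
  assumes "\<And>i. i \<in> I \<Longrightarrow> compact (S i)"
  shows "compact (PiE I S)"
proof -
  have "PiE I S = PiE UNIV (\<lambda>i. if i \<in> I then S i else {undefined})"
    by (auto simp: PiE_iff extensional_def split: if_splits)
  moreover have "compactin (product_topology (\<lambda>i. euclidean) UNIV)
      (PiE UNIV (\<lambda>i. if i \<in> I then S i else {undefined}))"
    unfolding compactin_PiE using assms by auto
  ultimately show ?thesis by (simp add: euclidean_product_topology)
qed

text \<open>Candidates no worse than \<open>f0\<close> lie in a compact box around \<open>Y\<close>,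
  and the continuous objective attains its minimum on the part of \<open>F\<close> in that
  box.\<close>

lemma least_squares_exists:
  fixes F :: "('a \<Rightarrow> real) set"
  assumes "finite I" and F: "F \<subseteq> I \<rightarrow>\<^sub>E UNIV" "closed F" "f0 \<in> F"
  shows "\<exists>f. is_arg_min (\<lambda>f. \<Sum>i\<in>I. (Y i - f i)\<^sup>2) (\<lambda>f. f \<in> F) f"
proof -
  define Q where "Q f = (\<Sum>i\<in>I. (Y i - f i)\<^sup>2)" for f
  \<comment> \<open>The radius works because a single squared residual is at most the whole
    sum.\<close>
  define K where "K = F \<inter> (\<Pi>\<^sub>E i\<in>I. cball (Y i) (sqrt (Q f0)))"
  have sub: "f \<in> K" if "f \<in> F" "Q f \<le> Q f0" for f
  proof -
    have "dist (Y i) (f i) \<le> sqrt (Q f0)" if "i \<in> I" for i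
    proof -
      have "(Y i - f i)\<^sup>2 \<le> Q f"
        unfolding Q_def using \<open>finite I\<close> that by (intro member_le_sum) auto
      then have "sqrt ((Y i - f i)\<^sup>2) \<le> sqrt (Q f0)" using \<open>Q f \<le> Q f0\<close> by (intro real_sqrt_le_mono) simp
      then show ?thesis by (simp add: dist_real_def)
    qed
    then show ?thesis using that F(1) by (auto simp: K_def PiE_iff)
  qed
  have "compact K"
    unfolding K_def using F(2) by (intro closed_Int_compact compact_PiE) auto
  moreover have "f0 \<in> K" using F(3) sub by simp
  moreover have "continuous_on K Q"
    unfolding Q_def
    by (intro continuous_intros continuous_on_subset[OF continuous_on_product_coordinates]) auto
  ultimately obtain f where f: "f \<in> K" "\<And>g. g \<in> K \<Longrightarrow> Q f \<le> Q g"
    using continuous_attains_inf[of K Q] by blast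
  \<comment> \<open>Either \<open>g\<close> is no worse than \<open>f0\<close> and lies in
    \<open>K\<close>, or it is worse than \<open>f0\<close>, hence than \<open>f\<close>.\<close>
  have "Q f \<le> Q g" if "g \<in> F" for g
    using f(2)[of g] f(2)[OF \<open>f0 \<in> K\<close>] sub[OF that] by linarith
  then have "is_arg_min Q (\<lambda>f. f \<in> F) f"
    using f(1) by (auto simp: is_arg_min_linorder K_def)
  then show ?thesis unfolding Q_def by blast
qed

section \<open>Flows along root-to-leaf paths\<close>

locale rooted = pair_graph G for G :: "nat pair_pre_digraph" +
  fixes n :: nat
  assumes rooted: "rooted_tree n G"
begin

lemma verts_eq: "pverts G = {1..n}" and two_le: "2 \<le> n"
  using rooted by (auto simp: rooted_tree_def)

lemma apath_unique: "apath u p v \<Longrightarrow> apath u q v \<Longrightarrow> p = q"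
  using rooted awalkI_apath[of u p v]
  by (metis awalk_hd_in_verts awalk_last_in_verts rooted_tree_def with_proj_simps(1))

section \<open>Paths from the root and their indicators as flows\<close>

definition root_path :: "nat \<Rightarrow> (nat \<times> nat) list" where
  "root_path v = (THE p. apath 1 p v)"

definition branch :: "nat \<Rightarrow> nat set" where
  "branch v = set (pawalk_verts 1 (root_path v))"

lemma root_path_eqI: "apath 1 p v \<Longrightarrow> root_path v = p"
  unfolding root_path_def using apath_unique by blast

lemma apath_root_path:
  assumes "v \<in> {1..n}"
  shows "apath 1 (root_path v) v"
proof -
  have "1 \<in> pverts G" "v \<in> pverts G" using verts_eq two_le assms by auto
  then have "\<exists>!p. apath 1 p v" using rooted unfolding rooted_tree_def by blast
  then show ?thesis unfolding root_path_def by (rule theI')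
qed

lemma awalk_root_path: "v \<in> {1..n} \<Longrightarrow> awalk 1 (root_path v) v"
  by (rule awalkI_apath[OF apath_root_path])

lemma children_iff: "j \<in> children G i \<longleftrightarrow> (\<exists>p. apath 1 (p @ [(i, j)]) j)"
  by (simp add: children_def)

lemma children_subset: "children G i \<subseteq> {1..n}"
  using awalk_last_in_verts[OF awalkI_apath] verts_eq by (fastforce simp: children_iff)

lemma branch_subset: "v \<in> {1..n} \<Longrightarrow> branch v \<subseteq> {1..n}"
  using awalk_root_path[of v] verts_eq awalkE'[of 1 "root_path v" v] unfolding branch_def
  by (metis awalk_conv with_proj_simps(1))

lemma self_in_branch: "v \<in> {1..n} \<Longrightarrow> v \<in> branch v"
  using awlast_if_cas[of 1 "root_path v" v] last_in_set[OF awalk_verts_non_Nil, of 1 "root_path v"]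
    awalk_root_path[of v]
  unfolding branch_def awalk_def by metis

text \<open>A prefix of a simple path is simple, so cutting the path after the arc leaves the path
  from the root to \<open>j\<close>.\<close>

lemma branch_arc_child:
  assumes "v \<in> {1..n}" and "(i, j) \<in> set (root_path v)"
  shows "j \<in> children G i"
proof -
  obtain p q where pq: "root_path v = (p @ [(i, j)]) @ q"
    using assms(2) by (metis append.assoc append_Cons append_Nil in_set_conv_decomp)
  have "apath 1 ((p @ [(i, j)]) @ q) v"
    using apath_root_path[OF assms(1)] pq by simp
  then have "apath 1 (p @ [(i, j)]) (last (pawalk_verts 1 (p @ [(i, j)])))"
    unfolding apath_append_iff[of 1 "p @ [(i, j)]" q v] by simp
  moreover have "last (pawalk_verts 1 (p @ [(i, j)])) = j" by (simp add: awalk_verts_conv)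
  ultimately show ?thesis by (auto simp: children_iff)
qed

text \<open>By uniqueness of paths, the part of the branch up to \<open>j\<close> is the path that
  witnesses \<open>j\<close> as a child of \<open>i\<close>, and its last arc is
  \<open>(i, j)\<close>.\<close>

lemma branch_child_arc:
  assumes "v \<in> {1..n}" "j \<in> branch v" "j \<in> children G i"
  shows "(i, j) \<in> set (root_path v)"
proof -
  obtain p where p: "apath 1 (p @ [(i, j)]) j" using assms(3) by (auto simp: children_iff)
  obtain q r where qr: "root_path v = q @ r" "awalk 1 q j"
    using awalk_decomp[OF awalk_root_path[OF assms(1)]] assms(2) unfolding branch_def by blast
  have "apath 1 (q @ r) v" using apath_root_path[OF assms(1)] qr(1) by simp
  then have "apath 1 q (last (pawalk_verts 1 q))" unfolding apath_append_iff[of 1 q r v] by simp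
  moreover have "last (pawalk_verts 1 q) = j" using qr(2) by simp
  ultimately have "q = p @ [(i, j)]" using p apath_unique by metis
  then show ?thesis using qr by simp
qed

text \<open>This makes the indicator of a branch a flow: at most one child of \<open>i\<close> is on
  the branch, and if one is, then so is \<open>i\<close>.\<close>

lemma branch_flow:
  assumes v: "v \<in> {1..n}"
  shows "(\<Sum>j\<in>children G i. indicator (branch v) j :: real) \<le> indicator (branch v) i"
proof -
  have d: "distinct (map fst (root_path v))"
    using apath_root_path[OF v]
    by (auto simp: apath_def awalk_verts_conv split: if_splits)
  have fin: "finite (children G i)" using children_subset finite_subset by blast
  have eq: "(\<Sum>j\<in>children G i. indicator (branch v) j :: real) = real (card (children G i \<inter> branch v))"
    using fin by (simp add: indicator_def sum.If_cases Int_def)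
  show ?thesis
  proof (cases "children G i \<inter> branch v = {}")
    case True
    then show ?thesis using eq by simp
  next
    case False
    then obtain j where j: "j \<in> children G i" "j \<in> branch v" by blast
    \<comment> \<open>A second child on the branch would give a second arc with tail
      \<open>i\<close>, but the tails along a simple path are distinct.\<close>
    have "children G i \<inter> branch v = {j}"
      using j d branch_child_arc[OF v] eq_key_imp_eq_value by fast
    moreover have "i \<in> branch v"
      using awalk_verts_arc1[OF branch_child_arc[OF v j(2,1)]] unfolding branch_def by simp
    ultimately show ?thesis using eq by simp
  qed
qed

section \<open>Counting leaves against the height\<close>

lemma leaves_subset: "leaves G \<subseteq> {1..n}"
  using verts_eq by (auto simp: leaves_def)

text \<open>A leaf on the branch other than its end would be the tail of an arc of the path and so
  have a child. This is the disjointness that the symmetrization requires.\<close>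

lemma branch_Int_leaves:
  assumes "k \<in> leaves G"
  shows "branch k \<inter> leaves G = {k}"
proof -
  have k: "k \<in> {1..n}" using assms leaves_subset by blast
  have "l = k" if l: "l \<in> branch k" "l \<in> leaves G" for l
  proof (rule ccontr)
    assume "l \<noteq> k"
    obtain q r where qr: "root_path k = q @ r" "awalk l r k"
      using awalk_decomp[OF awalk_root_path[OF k]] l(1) unfolding branch_def by blast
    then obtain e r' where r: "r = e # r'"
      using \<open>l \<noteq> k\<close> awalk_empty_ends by (cases r) auto
    then have "fst e = l" using qr(2) by (simp add: awalk_Cons_iff)
    then have "(l, snd e) \<in> set (root_path k)" using qr(1) r by auto
    then have "snd e \<in> children G l" by (rule branch_arc_child[OF k])
    then show False using l(2) by (simp add: leaves_def)
  qed
  then show ?thesis using assms self_in_branch[OF k] by blast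
qed

text \<open>\<open>height\<close> is defined through shortest walks. Shortcutting a shortest walk to
  \<open>k\<close> yields a simple path, which must be \<open>root_path k\<close>.\<close>

lemma length_root_path_le_height:
  assumes "k \<in> leaves G"
  shows "length (root_path k) \<le> height G"
proof -
  have k: "k \<in> {1..n}" using assms leaves_subset by blast
  have "\<exists>l p. awalk 1 p k \<and> length p = l"
    using awalk_root_path[OF k] by blast
  then have "\<exists>p. awalk 1 p k \<and> length p = graph_dist G 1 k"
    unfolding graph_dist_def by (rule LeastI_ex)
  then obtain p where p: "awalk 1 p k" "length p = graph_dist G 1 k" by blast
  have r: "root_path k = awalk_to_apath p"
    by (rule root_path_eqI[OF apath_awalk_to_apath[OF p(1)]])
  \<comment> \<open>Lengths are compared through arc sets: the path repeats no arc and uses only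
    arcs of the walk.\<close>
  have "distinct (root_path k)"
    using apath_root_path[OF k] distinct_verts_imp_distinct unfolding apath_def by blast
  then have "length (root_path k) = card (set (root_path k))" by (simp add: distinct_card)
  also have "\<dots> \<le> card (set p)"
    unfolding r by (rule card_mono[OF finite_set awalk_to_apath_subset[OF p(1)]])
  also have "\<dots> \<le> graph_dist G 1 k" using p(2) card_length by metis
  also have "\<dots> \<le> height G"
    unfolding height_def using assms leaves_subset
    by (intro Max_ge) (auto intro: finite_subset)
  finally show ?thesis .
qed

text \<open>Every node but the first is the head of an arc. Leaving out the common root gives the
  bound \<open>height G\<close> instead of \<open>height G + 1\<close>, which sharpens the count of
  leaves.\<close>

lemma card_branch_Diff_root: "k \<in> leaves G \<Longrightarrow> card (branch k - {1}) \<le> height G"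
proof -
  assume k: "k \<in> leaves G"
  then have "awalk 1 (root_path k) k" using awalk_root_path leaves_subset by blast
  then have "pawalk_verts 1 (root_path k) \<noteq> [] \<and> hd (pawalk_verts 1 (root_path k)) = 1"
    using awalk_verts_non_Nil awhd_of_awalk by simp
  then have "branch k - {1} \<subseteq> set (tl (pawalk_verts 1 (root_path k)))"
    unfolding branch_def by (cases "pawalk_verts 1 (root_path k)") auto
  then have "card (branch k - {1}) \<le> length (tl (pawalk_verts 1 (root_path k)))"
    by (meson card_length card_mono finite_set le_trans)
  also have "\<dots> = length (root_path k)" using length_awalk_verts by simp
  also note length_root_path_le_height[OF k]
  finally show ?thesis .
qed

lemma card_branch: "k \<in> leaves G \<Longrightarrow> card (branch k) \<le> height G + 1"
  using card_branch_Diff_root[of k] diff_card_le_card_Diff[of "{1}" "branch k"] by simp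

text \<open>Among the nodes whose branch contains \<open>v\<close>, one with the longest root path
  is a leaf, since a child of it would have a longer path still containing \<open>v\<close>.\<close>

lemma in_branch_of_leaf:
  assumes "v \<in> {1..n}"
  shows "\<exists>k\<in>leaves G. v \<in> branch k"
proof -
  define D where "D = {w \<in> {1..n}. v \<in> branch w}"
  have "finite D" "D \<noteq> {}" using assms self_in_branch by (auto simp: D_def)
  then obtain w where w: "w \<in> D" "\<And>x. x \<in> D \<Longrightarrow> length (root_path x) \<le> length (root_path w)"
    using Max_in[of "(\<lambda>x. length (root_path x)) ` D"] Max_ge[of "(\<lambda>x. length (root_path x)) ` D"]
    by (smt (verit, best) finite_imageI imageE imageI image_is_empty)
  have "w \<in> {1..n}" using w by (simp add: D_def)
  have "children G w = {}"
  proof (rule ccontr)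
    assume "children G w \<noteq> {}"
    then obtain j where j: "j \<in> children G w" by blast
    then obtain p where p: "apath 1 (p @ [(w, j)]) j" by (auto simp: children_iff)
    then have rj: "root_path j = p @ [(w, j)]" by (rule root_path_eqI)
    have jn: "j \<in> {1..n}" using j children_subset by blast
    have "apath 1 p (last (pawalk_verts 1 p))" "apath (last (pawalk_verts 1 p)) [(w, j)] j"
      using p unfolding apath_append_iff[of 1 p "[(w, j)]" j] by simp_all
    moreover from this(2) have "last (pawalk_verts 1 p) = w" by (simp add: apath_Cons_iff)
    ultimately have rw: "root_path w = p" using root_path_eqI by metis
    have "awalk 1 p w" using awalk_root_path[OF \<open>w \<in> {1..n}\<close>] rw by simp
    moreover have "awalk 1 (p @ [(w, j)]) j" using p by (rule awalkI_apath)
    ultimately have "branch w \<subseteq> branch j"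
      unfolding branch_def rw rj by (subst awalk_verts_append[of _ p "[(w, j)]" j]) auto
    then have "j \<in> D" using jn w(1) by (auto simp: D_def)
    then have "length (root_path j) \<le> length (root_path w)" by (rule w(2))
    then show False by (simp add: rj rw)
  qed
  then have "w \<in> leaves G" using w(1) verts_eq by (simp add: leaves_def D_def)
  then show ?thesis using w(1) by (auto simp: D_def)
qed

text \<open>The branches of the leaves, with the root removed, cover the other \<open>n - 1\<close>
  nodes and have at most \<open>height G\<close> elements each.\<close>

lemma card_le_leaves_height: "n \<le> 1 + card (leaves G) * height G"
proof -
  have fin: "finite (leaves G)" using leaves_subset finite_subset by blast
  have "{1..n} - {1} \<subseteq> (\<Union>k\<in>leaves G. branch k - {1})"
    using in_branch_of_leaf by blast
  moreover have "finite (\<Union>k\<in>leaves G. branch k - {1})"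
    using fin by (simp add: branch_def)
  ultimately have "card ({1..n} - {1}) \<le> card (\<Union>k\<in>leaves G. branch k - {1})"
    using card_mono by blast
  also have "\<dots> \<le> (\<Sum>k\<in>leaves G. card (branch k - {1}))"
    by (rule card_UN_le[OF fin])
  also have "\<dots> \<le> card (leaves G) * height G"
    using card_branch_Diff_root sum_bounded_above[of "leaves G" "\<lambda>k. card (branch k - {1})" "height G"] by simp
  finally show ?thesis using two_le by simp
qed

section \<open>Projection onto the cone of flows and the risk at zero\<close>

lemma closed_flows: "closed (flows G)"
proof -
  have "flows G = (\<Inter>i\<in>- pverts G. {f. f i = undefined}) \<inter>
      (\<Inter>i\<in>pverts G. {f. (\<Sum>j\<in>children G i. f j) \<le> f i})"
    by (auto simp: flows_def PiE_def extensional_def)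
  also have "closed \<dots>"
    by (intro closed_Int closed_INT ballI closed_Collect_eq closed_Collect_le continuous_intros
        continuous_on_product_coordinates)
  finally show ?thesis .
qed

definition zero_flow :: "nat \<Rightarrow> real" where
  "zero_flow = (\<lambda>i\<in>{1..n}. 0)"

lemma zero_flow_in_flows: "zero_flow \<in> flows G"
proof -
  have "(\<Sum>j\<in>children G i. zero_flow j) = 0" for i
    using children_subset[of i] by (intro sum.neutral) (auto simp: zero_flow_def subset_eq)
  then show ?thesis
    using verts_eq by (simp add: flows_def) (simp add: zero_flow_def)
qed

text \<open>Since a minimizer exists, the choice in \<open>lse\<close> returns one instead of an
  arbitrary value.\<close>

lemma lse_is_arg_min:
  "is_arg_min (\<lambda>f. \<Sum>i=1..n. (Y i - f i)\<^sup>2) (\<lambda>f. f \<in> flows G) (lse G Y)"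
proof -
  have "\<exists>f. is_arg_min (\<lambda>f. \<Sum>i=1..n. (Y i - f i)\<^sup>2) (\<lambda>f. f \<in> flows G) f"
    using zero_flow_in_flows closed_flows verts_eq
    by (intro least_squares_exists) (auto simp: flows_def)
  then show ?thesis
    unfolding lse_def arg_min_def verts_eq by (rule someI_ex)
qed

text \<open>With \<open>m\<close> the estimator and \<open>f\<close> the indicator of the branch,
  \<open>m + s * f\<close> is a flow for \<open>s > 0\<close>. Optimality of \<open>m\<close> then
  forces the inner product of \<open>Y - m\<close> with \<open>f\<close> to be at most 0. So
  \<open>t\<close> is at most the inner product of \<open>f\<close> and \<open>m\<close>, and
  Cauchy-Schwarz applies with squared norm of \<open>f\<close> at most
  \<open>height G + 1\<close>.\<close>

lemma branch_sum_le_lse_norm: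
  assumes k: "k \<in> leaves G" and t: "0 \<le> t" "t \<le> (\<Sum>i\<in>branch k. Y i)"
  shows "t\<^sup>2 \<le> (real (height G) + 1) * (\<Sum>i=1..n. (lse G Y i)\<^sup>2)"
proof -
  define m where "m = lse G Y"
  define f :: "nat \<Rightarrow> real" where "f = indicator (branch k)"
  have kn: "k \<in> {1..n}" using k leaves_subset by blast
  have m: "m \<in> flows G"
    and m_min: "g \<in> flows G \<Longrightarrow> (\<Sum>i=1..n. (Y i - m i)\<^sup>2) \<le> (\<Sum>i=1..n. (Y i - g i)\<^sup>2)" for g
    using lse_is_arg_min[of Y] by (auto simp: is_arg_min_linorder m_def)
  have sum_f: "(\<Sum>i=1..n. f i * g i) = (\<Sum>i\<in>branch k. g i)" for g :: "nat \<Rightarrow> real"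
  proof -
    have "(\<Sum>i=1..n. f i * g i) = (\<Sum>i\<in>{1..n} \<inter> branch k. g i)"
      unfolding f_def by (simp add: indicator_def sum.inter_restrict if_distrib cong: if_cong)
    then show ?thesis using branch_subset[OF kn] by (simp add: Int_absorb1)
  qed
  define d where "d = (\<Sum>i=1..n. f i * (Y i - m i))"
  define q where "q = (\<Sum>i=1..n. f i * f i)"
  have q: "q \<le> real (height G) + 1"
    using sum_f[of f] card_branch[OF k] by (simp add: q_def f_def)
  \<comment> \<open>Expanding the objective at \<open>m + s * f\<close> changes it by
    \<open>s\<^sup>2 * q - 2 * s * d\<close>, which cannot be negative.\<close>
  have "2 * d \<le> s * q" if s: "s > 0" for s
  proof -
    define g where "g = (\<lambda>i\<in>{1..n}. m i + s * f i)"
    have "(\<Sum>j\<in>children G i. g j) \<le> g i" if i: "i \<in> {1..n}" for i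
    proof -
      have "(\<Sum>j\<in>children G i. g j) = (\<Sum>j\<in>children G i. m j) + s * (\<Sum>j\<in>children G i. f j)"
      proof -
        have "(\<Sum>j\<in>children G i. g j) = (\<Sum>j\<in>children G i. m j + s * f j)"
          using children_subset[of i] by (intro sum.cong) (auto simp: g_def subset_eq)
        then show ?thesis by (simp add: sum.distrib sum_distrib_left)
      qed
      also have "\<dots> \<le> m i + s * f i"
        using m i verts_eq s branch_flow[OF kn, of i]
        by (intro add_mono mult_left_mono) (auto simp: flows_def f_def)
      finally show ?thesis using i by (simp add: g_def)
    qed
    then have "g \<in> flows G" using verts_eq by (auto simp: flows_def g_def)
    then have "(\<Sum>i=1..n. (Y i - m i)\<^sup>2) \<le> (\<Sum>i=1..n. (Y i - g i)\<^sup>2)" by (rule m_min)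
    also have "\<dots> = (\<Sum>i=1..n. (Y i - m i)\<^sup>2 - 2 * s * (f i * (Y i - m i)) + s\<^sup>2 * (f i * f i))"
      by (intro sum.cong) (auto simp: g_def power2_eq_square algebra_simps)
    also have "\<dots> = (\<Sum>i=1..n. (Y i - m i)\<^sup>2) - 2 * s * d + s\<^sup>2 * q"
      by (simp add: sum.distrib sum_subtractf sum_distrib_left d_def q_def)
    finally have "s * (2 * d) \<le> s * (s * q)" by (simp add: power2_eq_square algebra_simps)
    then show ?thesis using s by simp
  qed
  \<comment> \<open>Letting \<open>s\<close> tend to 0 from the right gives
    \<open>d \<le> 0\<close>.\<close>
  then have "\<forall>\<^sub>F s in at_right 0. 2 * d \<le> s * q"
    by (auto simp: eventually_at_filter)
  moreover have "((\<lambda>s. s * q) \<longlongrightarrow> 0 * q) (at_right 0)" by (intro tendsto_intros)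
  ultimately have "2 * d \<le> 0 * q"
    by (intro tendsto_lowerbound[where F = "at_right (0::real)"]) auto
  then have "t \<le> (\<Sum>i=1..n. f i * m i)"
    using t(2) sum_f[of Y] by (simp add: d_def sum_subtractf right_diff_distrib)
  then have "t\<^sup>2 \<le> (\<Sum>i=1..n. f i * m i)\<^sup>2" using t(1) by (rule power_mono)
  also have "\<dots> \<le> (\<Sum>i=1..n. (f i)\<^sup>2) * (\<Sum>i=1..n. (m i)\<^sup>2)"
    by (rule Cauchy_Schwarz_ineq_sum)
  also have "\<dots> \<le> (real (height G) + 1) * (\<Sum>i=1..n. (m i)\<^sup>2)"
    using q by (intro mult_right_mono sum_nonneg) (auto simp: q_def power2_eq_square)
  finally show ?thesis by (simp add: m_def)
qed

text \<open>On the event \<open>E\<close> some branch sum is large and the loss is at least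
  \<open>c\<close>, so the risk is at least \<open>c\<close> times the probability of
  \<open>E\<close>. In the constant, one factor 1/2 comes from the symmetrization and the other from
  \<open>h + 1 \<le> 2 * h\<close>.\<close>

lemma risk_zero_flow_ge:
  assumes \<sigma>: "0 < \<sigma>"
  shows "ennreal ((1 - exp (- tail_const)) / 4 * (\<sigma>\<^sup>2 / height G) * (ln (n / height G) / n))
    \<le> risk n G \<sigma> zero_flow"
proof -
  define M where "M = noise n \<sigma>"
  define h where "h = real (height G)"
  define L where "L = real (card (leaves G))"
  define t where "t = sqrt (ln (L + 1))"
  define p where "p = 1 - exp (- tail_const)"
  define E where "E = {\<epsilon> \<in> space M. \<exists>k\<in>leaves G. t * \<sigma> \<le> (\<Sum>i\<in>branch k. \<epsilon> i)}"
  define c where "c = (t * \<sigma>)\<^sup>2 / ((h + 1) * n)"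
  have M_eq: "M = (\<Pi>\<^sub>M i\<in>{1..n}. normal_law \<sigma>)" by (simp add: M_def noise_def)
  interpret M: prob_space M
    unfolding M_eq by (intro prob_space_PiM prob_space_normal_density \<sigma>)
  have n: "real n \<le> 1 + L * h"
    using card_le_leaves_height by (simp add: L_def h_def flip: of_nat_mult of_nat_Suc)
  \<comment> \<open>Height 0 or an empty set of leaves would give \<open>n \<le> 1\<close>.\<close>
  have h: "1 \<le> h" and ne: "leaves G \<noteq> {}"
    using card_le_leaves_height two_le by (auto simp: h_def Suc_le_eq intro!: gr0I)
  have t: "0 \<le> t" "t\<^sup>2 = ln (L + 1)" by (auto simp: t_def L_def)
  have branch_sub: "branch k \<subseteq> {1..n}" if "k \<in> leaves G" for k
    using that leaves_subset branch_subset by blast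
  have "p \<le> measure M {\<epsilon> \<in> space M. \<exists>k\<in>leaves G. t * \<sigma> \<le> \<epsilon> k}"
    unfolding M_eq p_def t_def L_def using \<sigma> leaves_subset ne by (intro prob_max_normal_ge) auto
  also have "\<dots> \<le> 2 * measure M E"
    unfolding M_eq E_def using \<sigma> leaves_subset branch_sub branch_Int_leaves
    by (intro prob_some_sum_ge) auto
  finally have prob_E: "p / 2 \<le> measure M E" by simp
  have p: "0 < p" using tail_const_pos by (simp add: p_def)
  have c: "0 \<le> c" using h by (simp add: c_def)
  have "p / 4 * (\<sigma>\<^sup>2 / h) * (ln (n / h) / n) = p * \<sigma>\<^sup>2 / (2 * n) * (ln (n / h) / (2 * h))"
    by simp
  also have "\<dots> \<le> p * \<sigma>\<^sup>2 / (2 * n) * (ln (L + 1) / (h + 1))"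
  proof (intro mult_left_mono frac_le)
    \<comment> \<open>Dividing \<open>n \<le> 1 + L * h\<close> by \<open>h \<ge> 1\<close>; the
      summand 1 in the threshold absorbs \<open>1 / h\<close>.\<close>
    have "n / h \<le> L + 1" using n h by (simp add: field_simps)
    then show "ln (n / h) \<le> ln (L + 1)" using h two_le by (intro ln_mono) auto
  qed (use h p in \<open>auto simp: L_def\<close>)
  also have "\<dots> = c * (p / 2)" using t by (simp add: c_def power_mult_distrib mult_ac)
  also have "\<dots> \<le> c * measure M E" using prob_E c by (intro mult_left_mono)
  finally have "ennreal (p / 4 * (\<sigma>\<^sup>2 / h) * (ln (n / h) / n)) \<le> ennreal c * emeasure M E"
    using c by (simp add: M.emeasure_eq_measure ennreal_leI flip: ennreal_mult)
  also have "\<dots> = (\<integral>\<^sup>+\<epsilon>. ennreal c * indicator E \<epsilon> \<partial>M)"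
  proof (cases "E \<in> sets M")
    case False \<comment> \<open>impossible, as the junk value 0 of the measure would be positive\<close>
    then have "measure M E = 0" by (rule measure_notin_sets)
    then show ?thesis using prob_E p by simp
  qed (simp add: nn_integral_cmult_indicator)
  also have "\<dots> \<le> risk n G \<sigma> zero_flow"
    unfolding risk_def M_def[symmetric]
  proof (intro nn_integral_mono)
    fix \<epsilon> assume "\<epsilon> \<in> space M"
    define Y where "Y = (\<lambda>i. zero_flow i + \<epsilon> i)"
    define loss where "loss = (1 / n) * (\<Sum>i=1..n. (lse G Y i - zero_flow i)\<^sup>2)"
    have "c \<le> loss" if \<epsilon>: "\<epsilon> \<in> E"
    proof -
      obtain k where k: "k \<in> leaves G" "t * \<sigma> \<le> (\<Sum>i\<in>branch k. \<epsilon> i)"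
        using \<epsilon> by (auto simp: E_def)
      have "(\<Sum>i\<in>branch k. \<epsilon> i) = (\<Sum>i\<in>branch k. Y i)"
        using branch_sub[OF k(1)] by (intro sum.cong) (auto simp: Y_def zero_flow_def subset_eq)
      then have "(t * \<sigma>)\<^sup>2 \<le> (h + 1) * (\<Sum>i=1..n. (lse G Y i)\<^sup>2)"
        using branch_sum_le_lse_norm[OF k(1)] k(2) t(1) \<sigma> by (simp add: h_def)
      then have "(t * \<sigma>)\<^sup>2 / (h + 1) \<le> (\<Sum>i=1..n. (lse G Y i)\<^sup>2)"
        using h by (simp add: pos_divide_le_eq mult.commute)
      then have "(t * \<sigma>)\<^sup>2 / (h + 1) / n \<le> (\<Sum>i=1..n. (lse G Y i)\<^sup>2) / n"
        by (intro divide_right_mono) auto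
      moreover have "loss = (1 / n) * (\<Sum>i=1..n. (lse G Y i)\<^sup>2)"
        by (simp add: loss_def zero_flow_def)
      ultimately show ?thesis by (simp add: c_def)
    qed
    then show "ennreal c * indicator E \<epsilon> \<le> ennreal ((1 / real n) *
        (\<Sum>i=1..n. (lse G (\<lambda>i. zero_flow i + \<epsilon> i) i - zero_flow i)\<^sup>2))"
      by (auto simp: indicator_def loss_def Y_def ennreal_leI)
  qed
  finally show ?thesis by (simp add: p_def h_def)
qed

end

theorem theorem2p3:
  "\<exists>C::real. C > 0 \<and>
     (\<forall>(n::nat) (G::nat pair_pre_digraph) (h::nat) (V::real) (\<sigma>::real).
        rooted_tree n G \<longrightarrow> h = height G \<longrightarrow> V \<ge> 0 \<longrightarrow> \<sigma> > 0 \<longrightarrow>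
        (SUP \<mu>\<in>{\<mu> \<in> flows G. \<mu> 1 \<le> V}. risk n G \<sigma> \<mu>)
          \<ge> ennreal (C * (\<sigma>\<^sup>2 / real h) * (ln (real n / real h) / real n)))"
proof (intro exI conjI allI impI)
  show "0 < (1 - exp (- tail_const)) / 4" using tail_const_pos by simp
next
  fix n G h V \<sigma>
  assume G: "rooted_tree n G" and h: "h = height G" and V: "(0::real) \<le> V" and \<sigma>: "(0::real) < \<sigma>"
  interpret rooted G n
    using G by (simp add: rooted_def rooted_axioms_def rooted_tree_def)
  \<comment> \<open>The zero flow is admissible for every \<open>V \<ge> 0\<close>, so its risk
    bounds the supremum from below uniformly in \<open>V\<close>.\<close>
  have "zero_flow 1 \<le> V" using V two_le by (simp add: zero_flow_def)
  then have "zero_flow \<in> {\<mu> \<in> flows G. \<mu> 1 \<le> V}" using zero_flow_in_flows by simp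
  then show "ennreal ((1 - exp (- tail_const)) / 4 * (\<sigma>\<^sup>2 / real h) * (ln (real n / real h) / real n))
      \<le> (SUP \<mu>\<in>{\<mu> \<in> flows G. \<mu> 1 \<le> V}. risk n G \<sigma> \<mu>)"
    using risk_zero_flow_ge[OF \<sigma>] unfolding h by (intro SUP_upper2)
qed

end
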